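(* Let $L$ be a finite modular semilattice and $B\subseteq L^n$ a $(\wedge,\vee)$-closed set, and suppose a Membership Oracle for $B$ is available. Then all bases $\mathbf{e}^i_l$ ($i\in[n]$, $l\in L$) of $B$ can be obtained with at most $n^2|L|^2$ calls of the Membership Oracle.
   Context: Semilattices are meet-semilattices; joins may not exist. A semilattice is modular if both of the following hold: every principal ideal is a modular lattice; and $x\vee y\vee z$ exists whenever $x\vee y$, $y\vee z$, $z\vee x$ exist. $L^n$ has the componentwise order, and $\mathbf{b}[i]$ is the $i$-th component. $B$ is $(\wedge,\vee)$-closed if both of the following hold: - $B$ is closed under $\wedge$; - $b_1\vee b_2\in B$ whenever $b_1,b_2\in B$ and $b_1\vee b_2$ exists in $L^n$. The base $\mathbf{e}^i_l=\min\{\mathbf{b}\in B\mid \mathbf{b}[i]=l\}$ is undefined if this set is empty; obtaining all bases means determining, for every $(i,l)$, whether $\mathbf{e}^i_l$ is defined and, if so, all its components. The Membership Oracle takes as input $i,j\in[n]$ and $l,l'\in L$, and answers whether there exists $\mathbf{b}\in B$ with $\mathbf{b}[i]=l$ and $\mathbf{b}[j]=l'$. *)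

theory Defs
  imports "HOL-Library.Lub_Glb" "HOL-Library.Cardinality"
begin

section \<open>Modular semilattices\<close>

text \<open>
  Joins are partial, so \<open>x \<squnion> y = s\<close> is the relation \<^term>\<open>isLub R {x, y} s\<close>
  (\<open>s\<close> is the least upper bound of \<open>x\<close> and \<open>y\<close> within the carrier \<open>R\<close>).
\<close>

definition modular_lattice_on :: "'a::semilattice_inf set \<Rightarrow> bool" where
  "modular_lattice_on I \<longleftrightarrow>
     (\<forall>x\<in>I. \<forall>y\<in>I. inf x y \<in> I) \<and>
     (\<forall>x\<in>I. \<forall>y\<in>I. \<exists>s. isLub I {x, y} s) \<and>
     (\<forall>x\<in>I. \<forall>y\<in>I. \<forall>z\<in>I. x \<le> z \<longrightarrow>
        (\<forall>s t. isLub I {x, y} s \<longrightarrow> isLub I {x, inf y z} t \<longrightarrow> t = inf s z))"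

definition modular_semilattice :: "'a::semilattice_inf itself \<Rightarrow> bool" where
  "modular_semilattice _ \<longleftrightarrow>
     (\<forall>p::'a. modular_lattice_on {..p}) \<and>
     (\<forall>x y z :: 'a.
        (\<exists>s. isLub UNIV {x, y} s) \<longrightarrow> (\<exists>s. isLub UNIV {y, z} s) \<longrightarrow>
        (\<exists>s. isLub UNIV {z, x} s) \<longrightarrow> (\<exists>s. isLub UNIV {x, y, z} s))"


section \<open>Closed subsets of \<open>L\<^sup>n\<close> and their bases\<close>

text \<open>
  An element of \<open>L\<^sup>n\<close> is a function from the finite index type \<^typ>\<open>'n\<close>, with
  \<open>n = CARD('n)\<close>; the order and the meet on functions are the componentwise ones.
\<close>

definition meet_join_closed :: "('n \<Rightarrow> 'a::semilattice_inf) set \<Rightarrow> bool" where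
  "meet_join_closed B \<longleftrightarrow>
     (\<forall>b1\<in>B. \<forall>b2\<in>B. inf b1 b2 \<in> B) \<and>
     (\<forall>b1\<in>B. \<forall>b2\<in>B. \<forall>s. isLub UNIV {b1, b2} s \<longrightarrow> s \<in> B)"

text \<open>\<open>is_base B i l e\<close>: the base for \<open>(i, l)\<close> is defined and equal to \<open>e\<close>.\<close>

definition is_base :: "('n \<Rightarrow> 'a::order) set \<Rightarrow> 'n \<Rightarrow> 'a \<Rightarrow> ('n \<Rightarrow> 'a) \<Rightarrow> bool" where
  "is_base B i l e \<longleftrightarrow> leastP (\<lambda>b. b \<in> B \<and> b i = l) e"

definition all_bases :: "('n \<Rightarrow> 'a::order) set \<Rightarrow> ('n \<Rightarrow> 'a \<Rightarrow> ('n \<Rightarrow> 'a) option) \<Rightarrow> bool" where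
  "all_bases B E \<longleftrightarrow>
     (\<forall>i l. case E i l of
               None \<Rightarrow> {b \<in> B. b i = l} = {}
             | Some e \<Rightarrow> is_base B i l e)"


section \<open>Oracle algorithms\<close>

definition membership_oracle :: "('n \<Rightarrow> 'a) set \<Rightarrow> 'n \<times> 'n \<times> 'a \<times> 'a \<Rightarrow> bool" where
  "membership_oracle B = (\<lambda>(i, j, l, l'). \<exists>b\<in>B. b i = l \<and> b j = l')"

text \<open>
  A deterministic adaptive algorithm with access to a yes/no oracle, as a decision tree:
  each call and the final result depend on the problem instance only through the answers
  received so far. Only oracle calls are counted as cost.
\<close>

datatype ('q, 'r) oracle_alg = Return 'r | Call 'q "bool \<Rightarrow> ('q, 'r) oracle_alg"

primrec result :: "('q \<Rightarrow> bool) \<Rightarrow> ('q, 'r) oracle_alg \<Rightarrow> 'r" where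
  "result orc (Return r) = r"
| "result orc (Call q k) = result orc (k (orc q))"

primrec calls :: "('q \<Rightarrow> bool) \<Rightarrow> ('q, 'r) oracle_alg \<Rightarrow> nat" where
  "calls orc (Return r) = 0"
| "calls orc (Call q k) = Suc (calls orc (k (orc q)))"

end

theory Submission
  imports Defs
begin

text \<open>
  There are exactly \<open>n\<^sup>2|L|\<^sup>2\<close> possible questions, so we may ask all of them. Since \<open>B\<close> is closed
  under meets, the finite set of \<open>b \<in> B\<close> with \<open>b i = l\<close> has a least element as soon as it is
  nonempty. The order being componentwise, the \<open>j\<close>-th component of this base is the least \<open>l'\<close>
  for which the question \<open>(i, j, l, l')\<close> is answered positively.
\<close>

text \<open>The continuation \<open>f\<close> receives the table of collected answers, which is \<^const>\<open>False\<close> off the list.\<close>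

primrec ask_all :: "'q list \<Rightarrow> (('q \<Rightarrow> bool) \<Rightarrow> 'r) \<Rightarrow> ('q, 'r) oracle_alg" where
  "ask_all [] f = Return (f (\<lambda>_. False))"
| "ask_all (q # qs) f = Call q (\<lambda>a. ask_all qs (\<lambda>g. f (g(q := a))))"

lemma result_ask_all: "result orc (ask_all qs f) = f (\<lambda>q. q \<in> set qs \<and> orc q)"
proof (induction qs arbitrary: f)
  case Nil
  then show ?case by simp
next
  case (Cons q qs)
  \<comment> \<open>If \<open>q\<close> recurs in \<open>qs\<close>, the update is harmless: both
    entries are \<open>orc q\<close>.\<close>
  have "(\<lambda>p. p \<in> set qs \<and> orc p)(q := orc q) = (\<lambda>p. p \<in> set (q # qs) \<and> orc p)"
    by (auto simp: fun_eq_iff)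
  then show ?case
    by (simp add: Cons.IH)
qed

lemma calls_ask_all: "calls orc (ask_all qs f) = length qs"
  by (induction qs arbitrary: f) auto

text \<open>A minimal \<open>m\<close> is already least: \<open>inf m x\<close> lies in
  \<open>S\<close> and below \<open>m\<close>, hence equals \<open>m\<close>.\<close>

lemma finite_inf_closed_has_least:
  fixes S :: "'b::semilattice_inf set"
  assumes "finite S" "S \<noteq> {}" and closed: "\<And>x y. x \<in> S \<Longrightarrow> y \<in> S \<Longrightarrow> inf x y \<in> S"
  shows "\<exists>m\<in>S. \<forall>x\<in>S. m \<le> x"
proof -
  obtain m where m: "m \<in> S" "\<And>b. b \<in> S \<Longrightarrow> b \<le> m \<Longrightarrow> m = b"
    using finite_has_minimal[OF assms(1,2)] by blast
  have "m \<le> x" if "x \<in> S" for x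
    using m(2)[OF closed[OF m(1) that]] by (metis inf_le1 inf_le2)
  with m(1) show ?thesis by blast
qed

text \<open>The diagonal question \<open>(i, i, l, l)\<close> asks whether any \<open>b\<close> in
  \<open>B\<close> has \<open>b i = l\<close>, so it decides whether the base is defined.\<close>

definition bases_of_answers ::
    "('n \<times> 'n \<times> 'a \<times> 'a \<Rightarrow> bool) \<Rightarrow> 'n \<Rightarrow> 'a \<Rightarrow> ('n \<Rightarrow> 'a::order) option" where
  "bases_of_answers g i l =
     (if g (i, i, l, l) then Some (\<lambda>j. LEAST l'. g (i, j, l, l')) else None)"

lemma all_bases_of_answers:
  fixes B :: "('n::finite \<Rightarrow> 'a::{finite, semilattice_inf}) set"
  assumes B: "meet_join_closed B"
  shows "all_bases B (bases_of_answers (membership_oracle B))"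
proof -
  have base: "is_base B i l (\<lambda>j. LEAST l'. membership_oracle B (i, j, l, l'))"
    if nonempty: "{b \<in> B. b i = l} \<noteq> {}" for i l
  proof -
    have "\<exists>e\<in>{b \<in> B. b i = l}. \<forall>x\<in>{b \<in> B. b i = l}. e \<le> x"
      using B nonempty by (intro finite_inf_closed_has_least) (auto simp: meet_join_closed_def)
    then obtain e where e: "e \<in> B" "e i = l" and least: "\<And>x. x \<in> B \<Longrightarrow> x i = l \<Longrightarrow> e \<le> x"
      by blast
    \<comment> \<open>The value \<open>e j\<close> is witnessed by \<open>e\<close> itself; any
      other witness lies above \<open>e\<close>, also at \<open>j\<close>.\<close>
    have "(LEAST l'. membership_oracle B (i, j, l, l')) = e j" for j
      using e least by (intro Least_equality) (auto simp: membership_oracle_def le_fun_def)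
    then show ?thesis
      using e least by (auto simp: is_base_def leastP_def setge_def)
  qed
  show ?thesis
    using base by (auto simp: all_bases_def bases_of_answers_def membership_oracle_def)
qed

theorem theorem3p8:
  assumes "modular_semilattice TYPE('a::{finite, semilattice_inf})"
  shows "\<exists>alg :: ('n::finite \<times> 'n \<times> 'a \<times> 'a, 'n \<Rightarrow> 'a \<Rightarrow> ('n \<Rightarrow> 'a) option) oracle_alg.
           \<forall>B :: ('n \<Rightarrow> 'a) set. meet_join_closed B \<longrightarrow>
             all_bases B (result (membership_oracle B) alg) \<and>
             calls (membership_oracle B) alg \<le> CARD('n)^2 * CARD('a)^2"
proof -
  \<comment> \<open>As \<open>qs\<close> lists every question, the collected table is the oracle
    itself; distinctness gives the count.\<close>
  obtain qs :: "('n \<times> 'n \<times> 'a \<times> 'a) list" where qs: "set qs = UNIV" "distinct qs"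
    using finite_distinct_list[OF finite] by blast
  have "length qs = CARD('n \<times> 'n \<times> 'a \<times> 'a)"
    using distinct_card[OF qs(2)] qs(1) by simp
  then have "length qs = CARD('n)^2 * CARD('a)^2"
    by (simp add: power2_eq_square)
  then show ?thesis
    by (intro exI[of _ "ask_all qs bases_of_answers"])
      (simp add: result_ask_all calls_ask_all qs(1) all_bases_of_answers)
qed

end
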